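(* Let $L^n_k$ be the number of lonely passengers at time $k$ in the $n$-detachment process and let $$R_{n,k}:=\frac{\mathrm{Var}^{(n)}(L^n_k)}{(E^{(n)}[L^n_k])^2}.$$ Let $n\to\infty$. Then (i) the critical regime for $R_{n,k}\to0$ is $k(n)\sim\dfrac{n}{\alpha\log n}$, and then $R_{n,k}\to0$ if and only if $\alpha<1$; if on the other hand $k(n)\gg\dfrac{n}{\log n}$, then $R_{n,k}\to0$; (ii) $c>1$ and $k(n)\le\dfrac{n}{c\log n}$ implies that for any $m\ge1$, $$P^{(n)}(\text{there exist at least } m \text{ lonely passengers})=P^{(n)}(L^n_k\ge m)\le\frac{1}{m\cdot n^{c-1+o(1)}},\qquad n\to\infty.$$
   Context: The $n$-detachment process ($n\ge1$): there are $n$ labeled passengers. At time $1$ all passengers sit in bus number $1$. At each integer time $k\ge 2$, a new bus with number $k$ becomes available and each passenger (currently sitting in one of the buses $1,\dots,k-1$), independently of the others and of the past, relocates to bus $k$ with probability $1/k$ and otherwise stays where they are. The process is extended to real times $t\ge1$ by letting its state at time $t$ be its state at time $\lfloor t\rfloor$. $P^{(n)},E^{(n)},\mathrm{Var}^{(n)}$ denote probability, expectation and variance for $n$ passengers. A passenger is lonely at time $k$ if no other passenger is in the same bus at time $k$. Throughout, $k=k(n)$ depends on $n$, and $\alpha>0$ is a constant. The notation $a_n\sim b_n$ means $a_n/b_n\to1$, $f(n)\gg g(n)$ means $g(n)=o(f(n))$, and $o(1)$ is a quantity tending to $0$ as $n\to\infty$; $\log$ is the natural logarithm.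
   Formalization: In (i), "R→0 iff α<1" is proved for each k(n) only when α≠1; at α=1 it is proved that R→0 fails for some k(n)∼n/log n, since for others, e.g. k=(n/log n)(1+1/√log n), R→0 does hold. *)

theory Defs
  imports "HOL-Probability.Probability" "HOL-Library.Landau_Symbols"
begin

text \<open>
  The process is realised on the space of independent relocation coins: coordinate
  \<open>(i, k)\<close> tells whether passenger \<open>i < n\<close> relocates to bus \<open>k\<close> at time \<open>k \<ge> 2\<close>,
  which happens with probability \<open>1 / k\<close>.
\<close>

definition detachment_space :: "nat \<Rightarrow> (nat \<times> nat \<Rightarrow> bool) measure" where
  "detachment_space n =
     (\<Pi>\<^sub>M (i, k) \<in> {..<n} \<times> {2..}. measure_pmf (bernoulli_pmf (1 / real k)))"

text \<open>The process starts at time 1; the value at time 0 is a dummy.\<close>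

fun bus :: "(nat \<times> nat \<Rightarrow> bool) \<Rightarrow> nat \<Rightarrow> nat \<Rightarrow> nat" where
  "bus \<omega> i 0 = 1"
| "bus \<omega> i (Suc 0) = 1"
| "bus \<omega> i (Suc (Suc k)) =
     (if \<omega> (i, Suc (Suc k)) then Suc (Suc k) else bus \<omega> i (Suc k))"

definition bus_at :: "(nat \<times> nat \<Rightarrow> bool) \<Rightarrow> nat \<Rightarrow> real \<Rightarrow> nat" where
  "bus_at \<omega> i t = bus \<omega> i (nat \<lfloor>t\<rfloor>)"

definition lonely :: "nat \<Rightarrow> real \<Rightarrow> (nat \<times> nat \<Rightarrow> bool) \<Rightarrow> nat \<Rightarrow> bool" where
  "lonely n t \<omega> i \<longleftrightarrow> (\<forall>j<n. j \<noteq> i \<longrightarrow> bus_at \<omega> j t \<noteq> bus_at \<omega> i t)"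

definition num_lonely :: "nat \<Rightarrow> real \<Rightarrow> (nat \<times> nat \<Rightarrow> bool) \<Rightarrow> nat" where
  "num_lonely n t \<omega> = card {i. i < n \<and> lonely n t \<omega> i}"

definition lonely_ratio :: "nat \<Rightarrow> real \<Rightarrow> real" where
  "lonely_ratio n t =
     prob_space.variance (detachment_space n) (\<lambda>\<omega>. real (num_lonely n t \<omega>)) /
     (prob_space.expectation (detachment_space n) (\<lambda>\<omega>. real (num_lonely n t \<omega>)))\<^sup>2"

end

theory Submission
  imports Defs "HOL-Real_Asymp.Real_Asymp"
begin

text \<open>
  At integer time \<open>K\<close> the passengers sit in independent uniformly chosen buses from \<open>{1..K}\<close>:
  the event that passenger \<open>i\<close> sits in bus \<open>f i\<close> for all \<open>i\<close> is a cylinder whose probability telescopes to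
  \<open>1 / K ^ n\<close>. Hence \<open>E L = n (1 - 1/K)^(n-1)\<close> and
  \<open>E (L (L - 1)) = n (n-1) (1 - 1/K) (1 - 2/K)^(n-2)\<close>, and since \<open>1 - 2/K \<le> (1 - 1/K)\<^sup>2\<close> the ratio
  \<open>R\<close> satisfies \<open>1 / E L - 1 \<le> R \<le> 1 / E L + 1 / (K - 1)\<close>. So \<open>R \<longlonglongrightarrow> 0\<close> is decided by whether
  \<open>E L\<close>, which is roughly \<open>n exp (- n / K)\<close>, tends to infinity. Part (ii) is Markov's inequality
  with \<open>\<epsilon> n = - c / n\<close>.
\<close>

section \<open>Joint law of the buses at an integer time\<close>

lemma bus_range: "1 \<le> K \<Longrightarrow> bus \<omega> i K \<in> {1..K}"
proof (induction K rule: nat_induct_at_least)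
  case (Suc K)
  then obtain m where "K = Suc m" by (cases K) auto
  with Suc show ?case by auto
qed auto

text \<open>Only the last successful coin matters: it comes up at time \<open>j\<close>, all later
  ones fail, and the earlier ones are free. The set \<open>{b. l < j \<or> b = (l = j)}\<close>
  covers the three cases in one formula, so the event is a cylinder with one side per coin. For
  \<open>j = 1\<close> no success is demanded, because the coins start at time 2.\<close>

lemma bus_eq_iff:
  assumes "1 \<le> K" "j \<in> {1..K}"
  shows "bus \<omega> i K = j \<longleftrightarrow> (\<forall>l\<in>{2..K}. \<omega> (i, l) \<in> {b. l < j \<or> b = (l = j)})"
  using assms
proof (induction K rule: nat_induct_at_least)
  case (Suc K)
  obtain m where m: "K = Suc m" using Suc.hyps by (cases K) auto
  have rng: "bus \<omega> i K \<in> {1..K}" using bus_range Suc.hyps by blast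
  have *: "{2..Suc K} = insert (Suc K) {2..K}" using m by auto
  show ?case
  proof (cases "j = Suc K")
    case True
    then show ?thesis using rng unfolding * by (auto simp: m)
  next
    case False
    then have "j \<in> {1..K}" using Suc.prems by auto
    with Suc.IH rng Suc.prems False show ?thesis unfolding * by (auto simp: m)
  qed
qed auto

lemma product_prob_space_coins:
  "product_prob_space (\<lambda>(i :: nat, k). measure_pmf (bernoulli_pmf (1 / real k)))"
  by (rule product_prob_spaceI) (auto split: prod.split intro: prob_space_measure_pmf)

lemma prob_space_detachment: "prob_space (detachment_space n)"
  unfolding detachment_space_def
  by (rule prob_space_PiM) (auto split: prod.split intro: prob_space_measure_pmf)

lemma measurable_bus [measurable]:
  assumes "i < n"
  shows "(\<lambda>\<omega>. bus \<omega> i K) \<in> measurable (detachment_space n) (count_space UNIV)"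
proof (induction K rule: induct_nat_012)
  case (ge2 k)
  have "(\<lambda>\<omega>. \<omega> (i, Suc (Suc k))) \<in> measurable (detachment_space n)
      (measure_pmf (bernoulli_pmf (1 / real (Suc (Suc k)))))"
    unfolding detachment_space_def
    using measurable_component_singleton[of "(i, Suc (Suc k))" "{..<n} \<times> {2..}"
        "\<lambda>(i, k). measure_pmf (bernoulli_pmf (1 / real k))"] assms
    by simp
  then have [measurable]: "(\<lambda>\<omega>. \<omega> (i, Suc (Suc k))) \<in> measurable (detachment_space n) (count_space UNIV)"
    by simp
  note ge2 [measurable]
  show ?case by simp
qed auto

text \<open>The factors are 1 for \<open>l < j\<close>, \<open>1 / j\<close> at \<open>l = j\<close>
  (absent when \<open>j = 1\<close>) and \<open>(l - 1) / l\<close> for \<open>l > j\<close>; the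
  last ones telescope to \<open>j / K\<close>.\<close>

lemma prod_relocation_prob:
  assumes "1 \<le> K" "j \<in> {1..K}"
  shows "(\<Prod>l=2..K. measure_pmf.prob (bernoulli_pmf (1 / real l)) {b. l < j \<or> b = (l = j)}) = 1 / real K"
  using assms
proof (induction K rule: nat_induct_at_least)
  case (Suc K)
  have K: "K \<ge> 1" using Suc.hyps .
  have *: "{2..Suc K} = insert (Suc K) {2..K}" using K by auto
  show ?case
  proof (cases "j = Suc K")
    case True
    have "(\<Prod>l=2..K. measure_pmf.prob (bernoulli_pmf (1 / real l)) {b. l < j \<or> b = (l = j)}) = 1"
      using True by (intro prod.neutral) auto
    moreover have "{b. Suc K < j \<or> b = (Suc K = j)} = {True}" using True by auto
    ultimately show ?thesis unfolding * by (simp add: measure_pmf_single)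
  next
    case False
    then have j: "j \<in> {1..K}" using Suc.prems by auto
    have "{b. Suc K < j \<or> b = (Suc K = j)} = {False}" using j by auto
    then show ?thesis unfolding * using Suc.IH[OF j] K
      by (simp add: measure_pmf_single) (simp add: field_simps flip: of_nat_mult of_nat_add)
  qed
qed auto

text \<open>Only the finitely many coins up to time \<open>K\<close> are constrained, so the
  infinite product measure reduces to a finite product. The coins of each passenger contribute
  \<open>1 / K\<close> whatever the target bus, which gives independence and uniformity at
  once.\<close>

lemma prob_bus_eq:
  assumes K: "1 \<le> K" and f: "\<And>i. i < n \<Longrightarrow> f i \<in> {1..K}"
  shows "measure (detachment_space n) {\<omega> \<in> space (detachment_space n). \<forall>i<n. bus \<omega> i K = f i} = (1 / real K) ^ n"
proof -
  let ?D = "\<lambda>(i :: nat, k). measure_pmf (bernoulli_pmf (1 / real k))"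
  let ?X = "\<lambda>(i, l). {b. l < f i \<or> b = (l = f i)}"
  let ?J = "{..<n} \<times> {2..K}"
  interpret product_prob_space ?D "{..<n} \<times> {2..}"
    by (rule product_prob_space_coins)
  have eq: "{\<omega> \<in> space (detachment_space n). \<forall>i<n. bus \<omega> i K = f i}
      = {\<omega> \<in> space (detachment_space n). \<forall>p\<in>?J. \<omega> p \<in> ?X p}"
    using bus_eq_iff[OF K f] by (auto simp: Ball_def)
  have "emeasure (detachment_space n) {\<omega> \<in> space (detachment_space n). \<forall>i<n. bus \<omega> i K = f i}
      = (\<Prod>p\<in>?J. emeasure (?D p) (?X p))"
    unfolding eq unfolding detachment_space_def
    by (rule emeasure_PiM_Collect) auto
  also have "\<dots> = ennreal (\<Prod>p\<in>?J. measure (?D p) (?X p))"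
    by (subst prod_ennreal[symmetric]) (auto simp: measure_pmf.emeasure_eq_measure intro!: prod.cong)
  also have "(\<Prod>p\<in>?J. measure (?D p) (?X p)) =
      (\<Prod>i<n. \<Prod>l=2..K. measure_pmf.prob (bernoulli_pmf (1 / real l)) {b. l < f i \<or> b = (l = f i)})"
    by (subst prod.cartesian_product) (auto intro!: prod.cong)
  also have "\<dots> = (\<Prod>i<n. 1 / real K)"
    by (intro prod.cong refl prod_relocation_prob K f) auto
  finally show ?thesis
    by (simp add: measure_def)
qed

text \<open>The assignments \<open>f\<close> with all \<open>f i \<in> A i\<close> split the event
  into disjoint atoms of equal probability, so only counting remains.\<close>

lemma prob_bus_in:
  assumes K: "1 \<le> K" and A: "\<And>i. i < n \<Longrightarrow> A i \<subseteq> {1..K}"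
  shows "measure (detachment_space n) {\<omega> \<in> space (detachment_space n). \<forall>i<n. bus \<omega> i K \<in> A i}
    = (\<Prod>i<n. real (card (A i)) / real K)"
proof -
  interpret prob_space "detachment_space n" by (rule prob_space_detachment)
  let ?E = "\<lambda>f. {\<omega> \<in> space (detachment_space n). \<forall>i<n. bus \<omega> i K = f i}"
  let ?F = "PiE {..<n} A"
  have finA: "finite (A i)" if "i < n" for i using A[OF that] finite_subset by blast
  have "{\<omega> \<in> space (detachment_space n). \<forall>i<n. bus \<omega> i K \<in> A i} = (\<Union>f\<in>?F. ?E f)"
  proof (intro equalityI subsetI)
    fix \<omega> assume "\<omega> \<in> {\<omega> \<in> space (detachment_space n). \<forall>i<n. bus \<omega> i K \<in> A i}"
    then show "\<omega> \<in> (\<Union>f\<in>?F. ?E f)"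
      \<comment> \<open>The restriction to \<open>{..<n}\<close> makes the assignment extensional,
        hence a member of \<open>?F\<close>. Distinct members of \<open>?F\<close> then differ at an
        actual passenger, which gives disjointness of the atoms below.\<close>
      by (intro UN_I[of "\<lambda>i\<in>{..<n}. bus \<omega> i K"]) auto
  qed (auto simp: PiE_iff)
  also have "prob \<dots> = (\<Sum>f\<in>?F. prob (?E f))"
  proof (rule finite_measure_finite_Union)
    show "finite ?F" using finA by (intro finite_PiE) auto
    show "?E ` ?F \<subseteq> events"
    proof (intro image_subsetI)
      fix f
      show "?E f \<in> events" by measurable
    qed
    show "disjoint_family_on ?E ?F"
      unfolding disjoint_family_on_def
    proof (intro ballI impI)
      fix f g assume "f \<in> ?F" "g \<in> ?F" "f \<noteq> g"
      then obtain i where "i < n" "f i \<noteq> g i"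
        by (metis PiE_ext lessThan_iff)
      then show "?E f \<inter> ?E g = {}" by force
    qed
  qed
  also have "\<dots> = (\<Sum>f\<in>?F. (1 / real K) ^ n)"
  proof (rule sum.cong)
    fix f assume "f \<in> ?F"
    then show "prob (?E f) = (1 / real K) ^ n"
      using A by (intro prob_bus_eq[OF K]) (force simp: PiE_iff)
  qed auto
  also have "\<dots> = (\<Prod>i<n. real (card (A i)) / real K)"
    by (simp add: card_PiE prod_dividef power_one_over divide_simps)
  finally show ?thesis .
qed

section \<open>Probability that one or two given passengers are lonely\<close>

lemma prod_lessThan_except1:
  fixes x y :: real
  assumes "i < n"
  shows "(\<Prod>l<n. if l = i then x else y) = x * y ^ (n - 1)"
  using assms by (simp add: prod.remove[of _ i])

lemma prod_lessThan_except2: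
  fixes x y :: real
  assumes "i < n" "j < n" "i \<noteq> j"
  shows "(\<Prod>l<n. if l = i \<or> l = j then x else y) = x * x * y ^ (n - 2)"
proof -
  have "(\<Prod>l<n. if l = i \<or> l = j then x else y)
      = (\<Prod>l\<in>{i, j}. if l = i \<or> l = j then x else y) * (\<Prod>l\<in>{..<n} - {i, j}. if l = i \<or> l = j then x else y)"
    using assms by (subst prod.subset_diff[of "{i, j}"]) (auto simp: mult.commute)
  also have "(\<Prod>l\<in>{..<n} - {i, j}. if l = i \<or> l = j then x else y) = (\<Prod>l\<in>{..<n} - {i, j}. y)"
    by (rule prod.cong) auto
  also have "\<dots> = y ^ (n - 2)"
    using assms by (simp add: card_Diff_subset numeral_2_eq_2)
  finally show ?thesis using assms by simp
qed

lemma measurable_lonely [measurable]: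
  assumes "i < n"
  shows "Measurable.pred (detachment_space n) (\<lambda>\<omega>. lonely n t \<omega> i)"
proof -
  note [measurable] = measurable_bus[OF assms]
  show ?thesis unfolding lonely_def bus_at_def by measurable
qed

text \<open>Split by the bus \<open>b\<close> of passenger \<open>i\<close>: \<open>i\<close> is
  pinned to \<open>b\<close> and everybody else is kept out of it, a box of probability
  \<open>(1 / K) * (1 - 1 / K) ^ (n - 1)\<close>. The \<open>K\<close> choices of \<open>b\<close>
  cancel the first factor.\<close>

lemma prob_lonely:
  assumes t: "1 \<le> t" and K: "K = nat \<lfloor>t\<rfloor>" and i: "i < n"
  shows "measure (detachment_space n) {\<omega> \<in> space (detachment_space n). lonely n t \<omega> i}
    = (1 - 1 / real K) ^ (n - 1)"
proof -
  interpret prob_space "detachment_space n" by (rule prob_space_detachment)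
  have K1: "1 \<le> K" using t K by linarith
  let ?A = "\<lambda>b l. if l = i then {b} else {1..K} - {b}"
  let ?E = "\<lambda>b. {\<omega> \<in> space (detachment_space n). \<forall>l<n. bus \<omega> l K \<in> ?A b l}"
  have event: "{\<omega> \<in> space (detachment_space n). lonely n t \<omega> i} = (\<Union>b\<in>{1..K}. ?E b)"
  proof (intro equalityI subsetI)
    fix \<omega> assume "\<omega> \<in> {\<omega> \<in> space (detachment_space n). lonely n t \<omega> i}"
    then show "\<omega> \<in> (\<Union>b\<in>{1..K}. ?E b)"
      using bus_range[OF K1, of \<omega>]
      by (intro UN_I[of "bus \<omega> i K"]) (auto simp: lonely_def bus_at_def K[symmetric])
  next
    fix \<omega> assume "\<omega> \<in> (\<Union>b\<in>{1..K}. ?E b)"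
    then obtain b where "\<omega> \<in> ?E b" by blast
    with i show "\<omega> \<in> {\<omega> \<in> space (detachment_space n). lonely n t \<omega> i}"
      by (auto simp: lonely_def bus_at_def K[symmetric] split: if_splits)
  qed
  have "prob {\<omega> \<in> space (detachment_space n). lonely n t \<omega> i} = (\<Sum>b\<in>{1..K}. prob (?E b))"
    unfolding event
  proof (rule finite_measure_finite_Union)
    show "?E ` {1..K} \<subseteq> events"
    proof (intro image_subsetI)
      fix b
      show "?E b \<in> events" by measurable
    qed
    show "disjoint_family_on ?E {1..K}"
      using i by (auto simp: disjoint_family_on_def)
  qed auto
  also have "\<dots> = (\<Sum>b\<in>{1..K}. (1 / real K) * (1 - 1 / real K) ^ (n - 1))"
  proof (rule sum.cong)
    fix b assume b: "b \<in> {1..K}"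
    have "prob (?E b) = (\<Prod>l<n. real (card (?A b l)) / real K)"
      using b by (intro prob_bus_in[OF K1]) (auto split: if_splits)
    also have "\<dots> = (\<Prod>l<n. if l = i then 1 / real K else 1 - 1 / real K)"
      using b K1 by (intro prod.cong) (auto simp: of_nat_diff diff_divide_distrib)
    finally show "prob (?E b) = (1 / real K) * (1 - 1 / real K) ^ (n - 1)"
      by (simp add: prod_lessThan_except1[OF i])
  qed auto
  finally show ?thesis using K1 by simp
qed

text \<open>Split by the ordered pair of distinct buses of \<open>i\<close> and \<open>j\<close>,
  which the other \<open>n - 2\<close> passengers must avoid. The \<open>K * (K - 1)\<close> pairs,
  each weighted with \<open>1 / K\<^sup>2\<close>, leave the factor
  \<open>1 - 1 / K\<close>.\<close>

lemma prob_two_lonely: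
  assumes t: "1 \<le> t" and K: "K = nat \<lfloor>t\<rfloor>" and ij: "i < n" "j < n" "i \<noteq> j"
  shows "measure (detachment_space n) {\<omega> \<in> space (detachment_space n). lonely n t \<omega> i \<and> lonely n t \<omega> j}
    = (1 - 1 / real K) * (1 - 2 / real K) ^ (n - 2)"
proof -
  interpret prob_space "detachment_space n" by (rule prob_space_detachment)
  have K1: "1 \<le> K" using t K by linarith
  let ?A = "\<lambda>(b, c) l. if l = i then {b} else if l = j then {c} else {1..K} - {b, c}"
  let ?E = "\<lambda>p. {\<omega> \<in> space (detachment_space n). \<forall>l<n. bus \<omega> l K \<in> ?A p l}"
  let ?P = "SIGMA b:{1..K}. {1..K} - {b}"
  have event: "{\<omega> \<in> space (detachment_space n). lonely n t \<omega> i \<and> lonely n t \<omega> j} = (\<Union>p\<in>?P. ?E p)"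
  proof (intro equalityI subsetI)
    fix \<omega> assume "\<omega> \<in> {\<omega> \<in> space (detachment_space n). lonely n t \<omega> i \<and> lonely n t \<omega> j}"
    then show "\<omega> \<in> (\<Union>p\<in>?P. ?E p)"
      using bus_range[OF K1, of \<omega>] ij
      by (intro UN_I[of "(bus \<omega> i K, bus \<omega> j K)"]) (auto simp: lonely_def bus_at_def K[symmetric])
  next
    fix \<omega> assume "\<omega> \<in> (\<Union>p\<in>?P. ?E p)"
    then obtain b c where "c \<noteq> b" and *: "\<omega> \<in> ?E (b, c)" by blast
    have "bus \<omega> i K = b" "bus \<omega> j K = c" using * ij by auto
    with * ij \<open>c \<noteq> b\<close> show "\<omega> \<in> {\<omega> \<in> space (detachment_space n). lonely n t \<omega> i \<and> lonely n t \<omega> j}"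
      by (auto simp: lonely_def bus_at_def K[symmetric] split: if_splits)
  qed
  have "prob {\<omega> \<in> space (detachment_space n). lonely n t \<omega> i \<and> lonely n t \<omega> j} = (\<Sum>p\<in>?P. prob (?E p))"
    unfolding event
  proof (rule finite_measure_finite_Union)
    show "?E ` ?P \<subseteq> events"
    proof (intro image_subsetI)
      fix p
      show "?E p \<in> events" by measurable
    qed
    show "disjoint_family_on ?E ?P"
      unfolding disjoint_family_on_def
    proof (intro ballI impI)
      fix p q :: "nat \<times> nat" assume "p \<noteq> q"
      have "p = (bus \<omega> i K, bus \<omega> j K)" if "\<omega> \<in> ?E p" for \<omega> and p :: "nat \<times> nat"
        using that ij by (cases p) auto
      with \<open>p \<noteq> q\<close> show "?E p \<inter> ?E q = {}" by blast
    qed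
  qed auto
  also have "\<dots> = (\<Sum>p\<in>?P. (1 / real K) * (1 / real K) * (1 - 2 / real K) ^ (n - 2))"
  proof (rule sum.cong)
    fix p assume "p \<in> ?P"
    moreover obtain b c where p: "p = (b, c)" by (cases p)
    ultimately have bc: "b \<in> {1..K}" "c \<in> {1..K}" "c \<noteq> b" by auto
    \<comment> \<open>Two distinct buses force \<open>K \<ge> 2\<close>, so \<open>K - 2\<close> is
      not truncated. For \<open>K = 1\<close> there are no pairs and the claimed value is 0 as
      well.\<close>
    then have "card {b, c} \<le> card {1..K}" by (intro card_mono) auto
    with bc have K2: "K \<ge> 2" by simp
    have "card ({1..K} - {b, c}) = K - 2"
      using bc by (subst card_Diff_subset) auto
    then have card: "card ({Suc 0..K} - {b, c}) = K - 2" by simp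
    have "prob (?E p) = (\<Prod>l<n. real (card (?A p l)) / real K)"
      using bc unfolding p by (intro prob_bus_in[OF K1]) (auto split: if_splits)
    also have "\<dots> = (\<Prod>l<n. if l = i \<or> l = j then 1 / real K else 1 - 2 / real K)"
      using K2 unfolding p by (intro prod.cong) (auto simp: card of_nat_diff diff_divide_distrib)
    finally show "prob (?E p) = (1 / real K) * (1 / real K) * (1 - 2 / real K) ^ (n - 2)"
      by (simp add: prod_lessThan_except2[OF ij])
  qed auto
  also have "card ?P = K * (K - 1)"
    by (subst card_SigmaI) auto
  then have "(\<Sum>p\<in>?P. (1 / real K) * (1 / real K) * (1 - 2 / real K) ^ (n - 2)) = (1 - 1 / real K) * (1 - 2 / real K) ^ (n - 2)"
    using K1 by (simp add: of_nat_diff field_simps)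
  finally show ?thesis .
qed

section \<open>First and second moment of the number of lonely passengers\<close>

lemma num_lonely_eq_sum:
  "real (num_lonely n t \<omega>) = (\<Sum>i<n. of_bool (lonely n t \<omega> i))"
  by (simp add: num_lonely_def sum.If_cases of_bool_def Int_def)

lemma measurable_num_lonely [measurable]:
  "(\<lambda>\<omega>. real (num_lonely n t \<omega>)) \<in> borel_measurable (detachment_space n)"
  unfolding num_lonely_eq_sum of_bool_def by measurable

lemma num_lonely_le: "num_lonely n t \<omega> \<le> n"
  using card_mono[of "{..<n}" "{i. i < n \<and> lonely n t \<omega> i}"] by (auto simp: num_lonely_def)

lemma integrable_num_lonely:
  "integrable (detachment_space n) (\<lambda>\<omega>. real (num_lonely n t \<omega>))"
proof -
  interpret prob_space "detachment_space n" by (rule prob_space_detachment)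
  show ?thesis using num_lonely_le by (intro integrable_const_bound[where B = "real n"]) auto
qed

lemma integrable_num_lonely_sq:
  "integrable (detachment_space n) (\<lambda>\<omega>. (real (num_lonely n t \<omega>))\<^sup>2)"
proof -
  interpret prob_space "detachment_space n" by (rule prob_space_detachment)
  show ?thesis using num_lonely_le
    by (intro integrable_const_bound[where B = "(real n)\<^sup>2"]) (auto intro!: power_mono)
qed

lemma integral_of_bool:
  assumes "prob_space M" "Measurable.pred M P"
  shows "(\<integral>x. of_bool (P x) \<partial>M) = measure M {x \<in> space M. P x}"
    and "integrable M (\<lambda>x. of_bool (P x) :: real)"
proof -
  interpret prob_space M by fact
  note assms(2)[measurable]
  have *: "(of_bool (P x) :: real) = indicator {x \<in> space M. P x} x" if "x \<in> space M" for x
    using that by (simp add: indicator_def)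
  have "(\<integral>x. of_bool (P x) \<partial>M) = (\<integral>x. indicator {x \<in> space M. P x} x \<partial>M)"
    by (rule Bochner_Integration.integral_cong) (auto simp: *)
  also have "\<dots> = prob {x \<in> space M. P x}"
    by (subst Bochner_Integration.integral_indicator) (auto intro!: arg_cong[where f = prob])
  finally show "(\<integral>x. of_bool (P x) \<partial>M) = measure M {x \<in> space M. P x}" .
  show "integrable M (\<lambda>x. of_bool (P x) :: real)"
    by (rule integrable_const_bound[where B = 1]) auto
qed

lemma expectation_num_lonely:
  assumes t: "1 \<le> t" and K: "K = nat \<lfloor>t\<rfloor>"
  shows "(\<integral>\<omega>. real (num_lonely n t \<omega>) \<partial>detachment_space n) = real n * (1 - 1 / real K) ^ (n - 1)"
  unfolding num_lonely_eq_sum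
  using prob_lonely[OF t K]
  by (subst Bochner_Integration.integral_sum)
    (auto simp: integral_of_bool[OF prob_space_detachment measurable_lonely])

text \<open>The square is the double sum of the pair indicators: each of the \<open>n\<close>
  diagonal pairs contributes \<open>?q1\<close>, each of the \<open>n * (n - 1)\<close> others
  \<open>?q2\<close>.\<close>

lemma second_moment_num_lonely:
  assumes t: "1 \<le> t" and K: "K = nat \<lfloor>t\<rfloor>"
  shows "(\<integral>\<omega>. (real (num_lonely n t \<omega>))\<^sup>2 \<partial>detachment_space n) =
    real n * (1 - 1 / real K) ^ (n - 1) + real n * (real n - 1) * ((1 - 1 / real K) * (1 - 2 / real K) ^ (n - 2))"
proof -
  let ?q1 = "(1 - 1 / real K) ^ (n - 1)" and ?q2 = "(1 - 1 / real K) * (1 - 2 / real K) ^ (n - 2)"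
  have sq: "(real (num_lonely n t \<omega>))\<^sup>2 = (\<Sum>i<n. \<Sum>j<n. of_bool (lonely n t \<omega> i \<and> lonely n t \<omega> j))" for \<omega>
    unfolding num_lonely_eq_sum power2_eq_square sum_product by (simp add: of_bool_conj)
  have meas: "Measurable.pred (detachment_space n) (\<lambda>\<omega>. lonely n t \<omega> i \<and> lonely n t \<omega> j)"
    if "i < n" "j < n" for i j
    using measurable_lonely[OF that(1)] measurable_lonely[OF that(2)] by measurable
  note ib = integral_of_bool[OF prob_space_detachment meas]
  have "(\<integral>\<omega>. (real (num_lonely n t \<omega>))\<^sup>2 \<partial>detachment_space n)
      = (\<Sum>i<n. \<integral>\<omega>. (\<Sum>j<n. of_bool (lonely n t \<omega> i \<and> lonely n t \<omega> j)) \<partial>detachment_space n)"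
    unfolding sq by (intro Bochner_Integration.integral_sum Bochner_Integration.integrable_sum ib(2)) auto
  also have "\<dots> = (\<Sum>i<n. \<Sum>j<n. \<integral>\<omega>. of_bool (lonely n t \<omega> i \<and> lonely n t \<omega> j) \<partial>detachment_space n)"
    by (intro sum.cong refl Bochner_Integration.integral_sum ib(2)) auto
  also have "\<dots> = (\<Sum>i<n. \<Sum>j<n. measure (detachment_space n) {\<omega> \<in> space (detachment_space n). lonely n t \<omega> i \<and> lonely n t \<omega> j})"
    by (intro sum.cong refl ib(1)) auto
  also have "\<dots> = (\<Sum>i<n. \<Sum>j<n. if j = i then ?q1 else ?q2)"
    by (intro sum.cong refl) (auto simp: prob_lonely[OF t K] prob_two_lonely[OF t K])
  also have "\<dots> = (\<Sum>i<n. ?q1 + (real n - 1) * ?q2)"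
  proof (intro sum.cong refl)
    fix i assume "i \<in> {..<n}"
    then show "(\<Sum>j<n. if j = i then ?q1 else ?q2) = ?q1 + (real n - 1) * ?q2"
      by (simp add: sum.remove[of _ i] of_nat_diff)
  qed
  finally show ?thesis by (simp add: algebra_simps)
qed

section \<open>The ratio controlled by the mean\<close>

lemma lonely_ratio_eq:
  fixes n :: nat
  assumes t: "1 \<le> t" and K: "K = nat \<lfloor>t\<rfloor>"
  defines "e \<equiv> real n * (1 - 1 / real K) ^ (n - 1)"
  shows "lonely_ratio n t = (e + real n * (real n - 1) * ((1 - 1 / real K) * (1 - 2 / real K) ^ (n - 2)) - e\<^sup>2) / e\<^sup>2"
  unfolding lonely_ratio_def e_def
  by (subst prob_space.variance_eq[OF prob_space_detachment integrable_num_lonely integrable_num_lonely_sq])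
    (simp only: expectation_num_lonely[OF t K] second_moment_num_lonely[OF t K])

text \<open>The variance is \<open>e + q - e\<^sup>2\<close> with \<open>e\<close> the mean and
  \<open>q\<close> the off-diagonal part of the second moment; dropping \<open>q \<ge> 0\<close>
  gives the bound. Having \<open>K \<ge> 2\<close> makes \<open>e\<close> positive and
  \<open>1 - 2 / K\<close> nonnegative.\<close>

lemma lonely_ratio_ge:
  assumes t: "2 \<le> t" and K: "K = nat \<lfloor>t\<rfloor>" and n: "1 \<le> n"
  shows "1 / (real n * (1 - 1 / real K) ^ (n - 1)) - 1 \<le> lonely_ratio n t"
proof -
  define e where "e = real n * (1 - 1 / real K) ^ (n - 1)"
  define q where "q = real n * (real n - 1) * ((1 - 1 / real K) * (1 - 2 / real K) ^ (n - 2))"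
  have K2: "2 \<le> K" using t K by linarith
  have "e > 0" using K2 n by (simp add: e_def)
  moreover have "q \<ge> 0" using K2 n by (simp add: q_def)
  moreover have "lonely_ratio n t = (e + q - e\<^sup>2) / e\<^sup>2"
    using lonely_ratio_eq[OF _ K] t by (simp add: e_def q_def)
  ultimately show ?thesis
    unfolding e_def[symmetric] by (simp add: add_divide_distrib diff_divide_distrib power2_eq_square)
qed

lemma lonely_ratio_nonneg: "0 \<le> lonely_ratio n t"
  unfolding lonely_ratio_def by simp

lemma lonely_ratio_le:
  assumes t: "2 \<le> t" and K: "K = nat \<lfloor>t\<rfloor>" and n: "2 \<le> n"
  shows "lonely_ratio n t \<le> 1 / (real K - 1) + 1 / (real n * (1 - 1 / real K) ^ (n - 1))"
proof -
  define x where "x = 1 - 1 / real K"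
  define e where "e = real n * x ^ (n - 1)"
  define q where "q = real n * (real n - 1) * (x * (1 - 2 / real K) ^ (n - 2))"
  have K2: "2 \<le> K" using t K by linarith
  have x: "x > 0" using K2 by (simp add: x_def)
  have e: "e > 0" using x n by (simp add: e_def)
  obtain m where m: "n = m + 2" using n by (metis add.commute le_Suc_ex)
  \<comment> \<open>Here \<open>x\<^sup>2\<close> exceeds \<open>1 - 2 / K\<close> by
    \<open>1 / K\<^sup>2\<close>. The resulting bound on \<open>q\<close> carries \<open>x\<close>
    to the power \<open>2 * n - 3\<close>, one less than \<open>e\<^sup>2\<close> does; the missing
    factor is the price \<open>1 / x\<close>.\<close>
  have "(1 - 2 / real K) ^ (n - 2) \<le> (x\<^sup>2) ^ (n - 2)"
    using K2 by (intro power_mono) (auto simp: x_def power2_eq_square algebra_simps)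
  then have "q \<le> real n * real n * (x * (x\<^sup>2) ^ (n - 2))"
    unfolding q_def using x n K2 by (intro mult_mono) auto
  also have "\<dots> = e\<^sup>2 / x"
    using x by (simp add: e_def m power2_eq_square power_mult_distrib field_simps)
  finally have "q \<le> e\<^sup>2 / x" .
  then have "q / e\<^sup>2 \<le> 1 / x"
    using e x by (simp add: field_simps)
  moreover have "lonely_ratio n t = (e + q - e\<^sup>2) / e\<^sup>2"
    using lonely_ratio_eq[OF _ K] t by (simp add: e_def q_def x_def)
  then have "lonely_ratio n t = 1 / e + q / e\<^sup>2 - 1"
    using e by (simp add: field_simps power2_eq_square)
  \<comment> \<open>The leading 1 cancels the \<open>- 1\<close> from the squared mean, so only the
    error \<open>1 / (K - 1)\<close> survives besides \<open>1 / e\<close>.\<close>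
  moreover have "1 / x = 1 + 1 / (real K - 1)"
    using K2 by (simp add: x_def field_simps)
  ultimately show ?thesis unfolding x_def[symmetric] e_def[symmetric] by simp
qed

section \<open>Exponential bounds on the mean\<close>

lemma expectation_num_lonely_le:
  assumes t: "1 \<le> t" and K: "K = nat \<lfloor>t\<rfloor>" and n: "1 \<le> n"
  shows "real n * (1 - 1 / real K) ^ (n - 1) \<le> real n * exp (- ((real n - 1) / t))"
proof -
  have K1: "1 \<le> K" "real K \<le> t" using t K by linarith+
  \<comment> \<open>Apply \<open>1 - u \<le> exp (- u)\<close> at \<open>u = 1 / K\<close>. As
    \<open>K \<le> t\<close>, passing to \<open>1 / t\<close> weakens the upper bound and removes
    the floor.\<close>
  have "1 - 1 / real K \<le> exp (- (1 / real K))"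
    using exp_ge_add_one_self[of "- (1 / real K)"] by simp
  also have "\<dots> \<le> exp (- (1 / t))"
    using K1 by (simp add: frac_le)
  finally have "(1 - 1 / real K) ^ (n - 1) \<le> exp (- (1 / t)) ^ (n - 1)"
    using K1 by (intro power_mono) auto
  also have "\<dots> = exp (- ((real n - 1) / t))"
    using n by (simp add: of_nat_diff flip: exp_of_nat_mult)
  finally show ?thesis by (intro mult_left_mono) auto
qed

text \<open>Uses \<open>ln (1 - u) \<ge> - u - 2 * u\<^sup>2\<close>, valid for
  \<open>0 \<le> u \<le> 1 / 2\<close>, at \<open>u = 1 / g\<close>. The real lower bound
  \<open>g\<close> stands in for \<open>K\<close> so that the limit computation involves no floor;
  the exponent \<open>n\<close> instead of \<open>n - 1\<close> lowers the bound, the base being at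
  most 1.\<close>

lemma expectation_num_lonely_ge:
  assumes g: "2 \<le> g" and K: "g \<le> real K" and n: "1 \<le> n"
  shows "real n * exp (- (real n * (1 / g + 2 / g\<^sup>2))) \<le> real n * (1 - 1 / real K) ^ (n - 1)"
proof -
  have "- (1 / g + 2 / g\<^sup>2) \<le> ln (1 - 1 / g)"
    using ln_one_minus_pos_lower_bound[of "1 / g"] g by (simp add: power_divide)
  then have "exp (- (1 / g + 2 / g\<^sup>2)) \<le> exp (ln (1 - 1 / g))"
    by (simp only: exp_le_cancel_iff)
  also have "\<dots> = 1 - 1 / g" using g by simp
  also have "\<dots> \<le> 1 - 1 / real K" using g K by (simp add: frac_le)
  finally have "exp (- (1 / g + 2 / g\<^sup>2)) ^ (n - 1) \<le> (1 - 1 / real K) ^ (n - 1)"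
    by (rule power_mono) auto
  moreover have "exp (- (1 / g + 2 / g\<^sup>2)) ^ n \<le> exp (- (1 / g + 2 / g\<^sup>2)) ^ (n - 1)"
    using g by (intro power_decreasing) (simp_all add: order_trans[of _ 0])
  moreover have "exp (- (1 / g + 2 / g\<^sup>2)) ^ n = exp (- (real n * (1 / g + 2 / g\<^sup>2)))"
    by (simp add: algebra_simps flip: exp_of_nat_mult)
  ultimately show ?thesis by (intro mult_left_mono) auto
qed

section \<open>Limit of the ratio in the various regimes\<close>

lemma lonely_ratio_tendsto_0:
  assumes \<beta>: "0 < \<beta>" "\<beta> < 1"
    and k: "\<forall>\<^sub>F n in at_top. real n / (\<beta> * ln (real n)) \<le> k n"
  shows "(\<lambda>n. lonely_ratio n (k n)) \<longlonglongrightarrow> 0"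
proof -
  \<comment> \<open>The subtracted 1 pays for rounding: the floor of \<open>k n\<close> is at least
    \<open>k n - 1\<close>, hence at least \<open>g n\<close>.\<close>
  define g where "g n = real n / (\<beta> * ln (real n)) - 1" for n :: nat
  have g_top: "filterlim g at_top at_top" using \<beta> unfolding g_def by real_asymp
  \<comment> \<open>Since \<open>n / g n\<close> is \<open>\<beta> * ln n + o(1)\<close>, the lower
    bound on the mean is of order \<open>n powr (1 - \<beta>)\<close>, which diverges as
    \<open>\<beta> < 1\<close>.\<close>
  have lim: "(\<lambda>n. 1 / (g n - 1) + 1 / (real n * exp (- (real n * (1 / g n + 2 / (g n)\<^sup>2))))) \<longlonglongrightarrow> 0"
    using \<beta> unfolding g_def by real_asymp
  have "\<forall>\<^sub>F n in at_top. lonely_ratio n (k n)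
      \<le> 1 / (g n - 1) + 1 / (real n * exp (- (real n * (1 / g n + 2 / (g n)\<^sup>2))))"
    using k eventually_ge_at_top[of 2] filterlim_at_top[THEN iffD1, OF g_top, rule_format, of 2]
  proof eventually_elim
    case (elim n)
    define K where "K = nat \<lfloor>k n\<rfloor>"
    have kn: "2 \<le> k n" "g n \<le> k n - 1" using elim by (auto simp: g_def)
    then have gK: "g n \<le> real K" "2 \<le> K" unfolding K_def by linarith+
    have pos: "0 < real n * exp (- (real n * (1 / g n + 2 / (g n)\<^sup>2)))" using elim by simp
    have "lonely_ratio n (k n) \<le> 1 / (real K - 1) + 1 / (real n * (1 - 1 / real K) ^ (n - 1))"
      by (rule lonely_ratio_le) (use kn elim K_def in auto)
    also have "1 / (real K - 1) \<le> 1 / (g n - 1)"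
      using gK elim by (intro frac_le) auto
    also have "1 / (real n * (1 - 1 / real K) ^ (n - 1))
        \<le> 1 / (real n * exp (- (real n * (1 / g n + 2 / (g n)\<^sup>2))))"
      using expectation_num_lonely_ge[of "g n" K n] gK elim pos by (intro frac_le) auto
    finally show ?case by simp
  qed
  then show ?thesis
    by (rule tendsto_sandwich[OF always_eventually _ tendsto_const lim, rotated])
      (simp add: lonely_ratio_nonneg)
qed

text \<open>The summand 1 beside the logarithm pushes the mean eventually below
  \<open>1 / 2\<close>, and then the lower bound \<open>1 / e - 1\<close> on the ratio exceeds
  1.\<close>

lemma lonely_ratio_not_tendsto_0:
  assumes k2: "\<forall>\<^sub>F n in at_top. 2 \<le> k n"
    and k: "\<forall>\<^sub>F n in at_top. k n \<le> real n / (ln (real n) + 1)"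
  shows "\<not> (\<lambda>n. lonely_ratio n (k n)) \<longlonglongrightarrow> 0"
proof
  assume "(\<lambda>n. lonely_ratio n (k n)) \<longlonglongrightarrow> 0"
  then have "\<forall>\<^sub>F n in at_top. lonely_ratio n (k n) < 1"
    by (rule order_tendstoD) auto
  moreover have "\<forall>\<^sub>F n in at_top. real n * exp (- ((real n - 1) * (ln (real n) + 1) / real n)) < 1 / 2"
  proof (rule order_tendstoD)
    show "(\<lambda>n. real n * exp (- ((real n - 1) * (ln (real n) + 1) / real n))) \<longlonglongrightarrow> exp (-1)"
      by real_asymp
    show "exp (-1) < (1 / 2 :: real)"
      \<comment> \<open>\<open>exp 1 \<ge> 1 + 1 + 1 / 2 > 2\<close>.\<close>
      using exp_lower_Taylor_quadratic[of "1::real"] by (simp add: exp_minus field_simps)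
  qed
  ultimately have "\<forall>\<^sub>F n in at_top :: nat filter. False"
    using k2 k eventually_ge_at_top[of 1]
  proof eventually_elim
    case (elim n)
    define K where "K = nat \<lfloor>k n\<rfloor>"
    define e where "e = real n * (1 - 1 / real K) ^ (n - 1)"
    have "2 \<le> K" using elim K_def by linarith
    then have "e > 0" using elim by (simp add: e_def)
    have "e \<le> real n * exp (- ((real n - 1) / k n))"
      unfolding e_def by (rule expectation_num_lonely_le) (use elim K_def in auto)
    also have "(real n - 1) * (ln (real n) + 1) / real n \<le> (real n - 1) / k n"
    proof -
      have "1 / (real n / (ln (real n) + 1)) \<le> 1 / k n"
        using elim by (intro frac_le) auto
      from mult_left_mono[OF this, of "real n - 1"] show ?thesis using elim by simp
    qed
    then have "real n * exp (- ((real n - 1) / k n))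
      \<le> real n * exp (- ((real n - 1) * (ln (real n) + 1) / real n))"
      by (intro mult_left_mono) (simp_all only: exp_le_cancel_iff neg_le_iff_le of_nat_0_le_iff)
    also have "\<dots> < 1 / 2" by fact
    finally have "2 < 1 / e" using \<open>e > 0\<close> by (simp add: field_simps)
    moreover have "1 / e - 1 \<le> lonely_ratio n (k n)"
      unfolding e_def by (rule lonely_ratio_ge) (use elim K_def in auto)
    ultimately show False using elim by simp
  qed
  then show False by simp
qed

text \<open>A strictly larger or smaller constant than \<alpha> absorbs the factor
  \<open>1 + o(1)\<close>, turning the equivalence into the one-sided bounds that the limit lemmas
  take.\<close>

lemma critical_bounds:
  fixes k :: "nat \<Rightarrow> real"
  assumes \<alpha>: "\<alpha> > 0" and k: "k \<sim>[at_top] (\<lambda>n. real n / (\<alpha> * ln (real n)))"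
  shows "\<beta> > \<alpha> \<Longrightarrow> \<forall>\<^sub>F n in at_top. real n / (\<beta> * ln (real n)) \<le> k n"
    and "0 < \<gamma> \<Longrightarrow> \<gamma> < \<alpha> \<Longrightarrow> \<forall>\<^sub>F n in at_top. k n \<le> real n / (\<gamma> * ln (real n))"
proof -
  have gt1: "\<forall>\<^sub>F n::nat in at_top. 1 < n" by (rule eventually_gt_at_top)
  \<comment> \<open>Asymptotic equivalence counts a quotient 0/0 as 1; excluding that case yields a
    genuine limit of the quotient.\<close>
  have "\<forall>\<^sub>F n in at_top. k n \<noteq> 0 \<or> real n / (\<alpha> * ln (real n)) \<noteq> 0"
    using gt1 by eventually_elim (use \<alpha> in auto)
  with k have "(\<lambda>n. k n / (real n / (\<alpha> * ln (real n)))) \<longlonglongrightarrow> 1"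
    by (rule asymp_equivD_strong)
  note lim = order_tendstoD[OF this]
  show "\<forall>\<^sub>F n in at_top. real n / (\<beta> * ln (real n)) \<le> k n" if "\<beta> > \<alpha>"
  proof -
    have "\<alpha> / \<beta> < 1" using that \<alpha> by simp
    from lim(1)[OF this] gt1 show ?thesis
    proof eventually_elim
      case (elim n)
      have "0 < ln (real n)" using elim by simp
      with elim that \<alpha> show ?case by (simp add: field_simps)
    qed
  qed
  show "\<forall>\<^sub>F n in at_top. k n \<le> real n / (\<gamma> * ln (real n))" if "0 < \<gamma>" "\<gamma> < \<alpha>"
  proof -
    have "1 < \<alpha> / \<gamma>" using that by simp
    from lim(2)[OF this] gt1 show ?thesis
    proof eventually_elim
      case (elim n)
      have "0 < ln (real n)" using elim by simp
      with elim that \<alpha> show ?case by (simp add: field_simps)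
    qed
  qed
qed

text \<open>Away from 1 there is room for a constant strictly between \<alpha> and 1, with which the
  one-sided criteria apply.\<close>

lemma lonely_ratio_critical:
  fixes k :: "nat \<Rightarrow> real"
  assumes "\<alpha> > 0" "\<alpha> \<noteq> 1" and k: "k \<sim>[at_top] (\<lambda>n. real n / (\<alpha> * ln (real n)))"
  shows "(\<lambda>n. lonely_ratio n (k n)) \<longlonglongrightarrow> 0 \<longleftrightarrow> \<alpha> < 1"
proof (cases "\<alpha> < 1")
  case True
  then obtain \<beta> where "\<alpha> < \<beta>" "\<beta> < 1" using dense by blast
  with True critical_bounds(1)[OF \<open>\<alpha> > 0\<close> k] lonely_ratio_tendsto_0[of \<beta> k] \<open>\<alpha> > 0\<close> show ?thesis by auto
next
  case False
  with assms obtain \<gamma> where \<gamma>: "1 < \<gamma>" "\<gamma> < \<alpha>" using dense[of 1 \<alpha>] by auto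
  \<comment> \<open>The constant \<open>2 * \<alpha>\<close> is just one above \<alpha>; it serves
    to show that \<open>k n\<close> is eventually at least 2.\<close>
  have "\<forall>\<^sub>F n in at_top. 2 \<le> real n / (2 * \<alpha> * ln (real n))"
    using \<open>\<alpha> > 0\<close> by real_asymp
  with critical_bounds(1)[OF \<open>\<alpha> > 0\<close> k, of "2 * \<alpha>"] have k2: "\<forall>\<^sub>F n in at_top. 2 \<le> k n"
    using \<open>\<alpha> > 0\<close> by (auto elim: eventually_elim2)
  \<comment> \<open>From this threshold on, \<open>\<gamma> * ln n\<close> is at least
    \<open>ln n + 1\<close>.\<close>
  have "\<forall>\<^sub>F n::nat in at_top. 1 / (\<gamma> - 1) \<le> ln (real n)"
    by real_asymp
  then have "\<forall>\<^sub>F n in at_top. real n / (\<gamma> * ln (real n)) \<le> real n / (ln (real n) + 1)"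
    using eventually_gt_at_top[of 1]
  proof eventually_elim
    case (elim n)
    then have "ln (real n) + 1 \<le> \<gamma> * ln (real n)" using \<gamma> by (simp add: field_simps)
    moreover have "0 < ln (real n)" using elim by simp
    ultimately show ?case using \<gamma> by (intro divide_left_mono) auto
  qed
  with critical_bounds(2)[OF \<open>\<alpha> > 0\<close> k, of \<gamma>] have "\<forall>\<^sub>F n in at_top. k n \<le> real n / (ln (real n) + 1)"
    using \<gamma> by (auto elim: eventually_elim2)
  with lonely_ratio_not_tendsto_0[OF k2] False show ?thesis by simp
qed

text \<open>
  The summand 1 in the denominator keeps the expected number of lonely passengers bounded also when
  \<open>\<alpha> = 1\<close>, so that this single choice of \<open>k\<close> covers the boundary case.
\<close>

lemma critical_counterexample:
  assumes "\<alpha> \<ge> 1"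
  obtains k :: "nat \<Rightarrow> real" where "\<And>n. 1 \<le> k n" "k \<sim>[at_top] (\<lambda>n. real n / (\<alpha> * ln (real n)))"
    "\<not> (\<lambda>n. lonely_ratio n (k n)) \<longlonglongrightarrow> 0"
proof
  let ?f = "\<lambda>n::nat. real n / (\<alpha> * ln (real n) + 1)"
  let ?k = "\<lambda>n. max 1 (?f n)"
  have "filterlim ?f at_top at_top" using assms by real_asymp
  then have f2: "\<forall>\<^sub>F n in at_top. 2 \<le> ?f n" by (simp only: filterlim_at_top)
  show "1 \<le> ?k n" for n by simp
  have "?f \<sim>[at_top] (\<lambda>n. real n / (\<alpha> * ln (real n)))" using assms by real_asymp
  moreover have "\<forall>\<^sub>F n in at_top. ?f n = ?k n" using f2 by (auto elim!: eventually_mono)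
  ultimately show "?k \<sim>[at_top] (\<lambda>n. real n / (\<alpha> * ln (real n)))"
    by (rule asymp_equiv_transfer) simp
  show "\<not> (\<lambda>n. lonely_ratio n (?k n)) \<longlonglongrightarrow> 0"
  proof (rule lonely_ratio_not_tendsto_0)
    show "\<forall>\<^sub>F n in at_top. 2 \<le> ?k n" using f2 by (auto elim!: eventually_mono)
    show "\<forall>\<^sub>F n in at_top. ?k n \<le> real n / (ln (real n) + 1)"
      using f2 eventually_ge_at_top[of 1]
    proof eventually_elim
      case (elim n)
      have "0 \<le> ln (real n)" using elim by simp
      then have "ln (real n) \<le> \<alpha> * ln (real n)" using assms mult_right_mono[of 1 \<alpha>] by fastforce
      then have "?f n \<le> real n / (ln (real n) + 1)"
        using \<open>0 \<le> ln (real n)\<close> by (intro divide_left_mono) auto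
      with elim show ?case by simp
    qed
  qed
qed

lemma lonely_ratio_supercritical:
  assumes k1: "\<forall>n\<ge>1. 1 \<le> k n" and k: "(\<lambda>n. real n / ln (real n)) \<in> o(k)"
  shows "(\<lambda>n. lonely_ratio n (k n)) \<longlonglongrightarrow> 0"
\<comment> \<open>Any constant in \<open>(0, 1)\<close> would do: the little-o hypothesis puts
  \<open>k n\<close> above every multiple of \<open>n / ln n\<close>, and \<open>1 \<le> k n\<close>
  removes the absolute value.\<close>
proof (rule lonely_ratio_tendsto_0[of "1 / 2"])
  have "\<forall>\<^sub>F n in at_top. norm (real n / ln (real n)) \<le> 1 / 2 * norm (k n)"
    by (rule landau_o.smallD[OF k]) simp
  then show "\<forall>\<^sub>F n in at_top. real n / (1 / 2 * ln (real n)) \<le> k n"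
    using eventually_ge_at_top[of 2]
  proof eventually_elim
    case (elim n)
    have "1 \<le> k n" using elim k1 by simp
    with elim show ?case by simp
  qed
qed auto

section \<open>Tail bound for the number of lonely passengers\<close>

lemma prob_num_lonely_ge_le:
  assumes t: "1 \<le> t" "t \<le> real n / (c * ln (real n))" and n: "2 \<le> n" and c: "0 < c" and m: "1 \<le> m"
  shows "measure (detachment_space n) {\<omega> \<in> space (detachment_space n). m \<le> num_lonely n t \<omega>}
    \<le> 1 / (real m * real n powr (c - 1 - c / real n))"
proof -
  interpret prob_space "detachment_space n" by (rule prob_space_detachment)
  have ln: "ln (real n) > 0" using n by simp
  have "prob {\<omega> \<in> space (detachment_space n). m \<le> num_lonely n t \<omega>}
      = prob {\<omega> \<in> space (detachment_space n). real m \<le> real (num_lonely n t \<omega>)}"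
    by simp
  also have "\<dots> \<le> expectation (\<lambda>\<omega>. real (num_lonely n t \<omega>)) / real m"
    using m by (intro integral_Markov_inequality_measure[where A = "{}"] integrable_num_lonely) auto
  also have "expectation (\<lambda>\<omega>. real (num_lonely n t \<omega>)) \<le> real n * exp (- ((real n - 1) / t))"
    unfolding expectation_num_lonely[OF t(1) refl]
    by (rule expectation_num_lonely_le) (use t n in auto)
  also have "(real n - 1) * (c * ln (real n)) / real n \<le> (real n - 1) / t"
  proof -
    have "c * ln (real n) / real n \<le> 1 / t"
      using t n c ln by (auto simp: field_simps)
    from mult_left_mono[OF this, of "real n - 1"] show ?thesis using n by simp
  qed
  then have "real n * exp (- ((real n - 1) / t)) \<le> real n * exp (- ((real n - 1) * (c * ln (real n)) / real n))"
    by (intro mult_left_mono) (simp_all only: exp_le_cancel_iff neg_le_iff_le of_nat_0_le_iff)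
  also have "\<dots> = 1 / real n powr (c - 1 - c / real n)"
  proof -
    have "real n * exp (- ((real n - 1) * (c * ln (real n)) / real n))
        = exp (ln (real n) - (real n - 1) * (c * ln (real n)) / real n)"
      using n by (simp only: diff_conv_add_uminus exp_add) simp
    \<comment> \<open>The correction \<open>- c / n\<close> in the exponent arises because only the
      \<open>n - 1\<close> other passengers enter the exponential bound.\<close>
    also have "ln (real n) - (real n - 1) * (c * ln (real n)) / real n = - ((c - 1 - c / real n) * ln (real n))"
      using n by (simp add: field_simps)
    finally show ?thesis using n by (simp add: powr_def exp_minus field_simps)
  qed
  finally show ?thesis using m by (simp add: divide_right_mono field_simps)
qed

text \<open>The set of all lonely passengers is the largest possible witness. This identifies the
  two events in part (ii).\<close>

lemma ex_lonely_subset_iff: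
  "(\<exists>A\<subseteq>{..<n}. m \<le> card A \<and> (\<forall>i\<in>A. lonely n t \<omega> i)) \<longleftrightarrow> m \<le> num_lonely n t \<omega>"
proof
  assume "\<exists>A\<subseteq>{..<n}. m \<le> card A \<and> (\<forall>i\<in>A. lonely n t \<omega> i)"
  then obtain A where A: "A \<subseteq> {..<n}" "m \<le> card A" "\<forall>i\<in>A. lonely n t \<omega> i" by blast
  then have "card A \<le> num_lonely n t \<omega>"
    unfolding num_lonely_def by (intro card_mono) auto
  with A show "m \<le> num_lonely n t \<omega>" by simp
next
  assume "m \<le> num_lonely n t \<omega>"
  then show "\<exists>A\<subseteq>{..<n}. m \<le> card A \<and> (\<forall>i\<in>A. lonely n t \<omega> i)"
    by (intro exI[of _ "{i. i < n \<and> lonely n t \<omega> i}"]) (auto simp: num_lonely_def)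
qed

text \<open>At \<open>\<alpha> = 1\<close> the equivalence does not determine whether the mean stays
  bounded. Hence the threshold appears twice: quantified over all admissible \<open>k\<close>, where
  \<open>\<alpha> = 1\<close> fails through one bad \<open>k\<close>, and as a dichotomy for each
  single \<open>k\<close> when \<open>\<alpha> \<noteq> 1\<close>.\<close>

theorem theorem2p5:
  shows
    "(\<forall>\<alpha>::real. \<alpha> > 0 \<longrightarrow>
       ((\<forall>k::nat \<Rightarrow> real. (\<forall>n\<ge>1. 1 \<le> k n) \<longrightarrow>
           k \<sim>[at_top] (\<lambda>n. real n / (\<alpha> * ln (real n))) \<longrightarrow>
           (\<lambda>n. lonely_ratio n (k n)) \<longlonglongrightarrow> 0)
         \<longleftrightarrow> \<alpha> < 1)) \<and>
     (\<forall>(\<alpha>::real) (k::nat \<Rightarrow> real). \<alpha> > 0 \<longrightarrow> \<alpha> \<noteq> 1 \<longrightarrow> (\<forall>n\<ge>1. 1 \<le> k n) \<longrightarrow>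
       k \<sim>[at_top] (\<lambda>n. real n / (\<alpha> * ln (real n))) \<longrightarrow>
       ((\<lambda>n. lonely_ratio n (k n)) \<longlonglongrightarrow> 0 \<longleftrightarrow> \<alpha> < 1)) \<and>
     (\<forall>k::nat \<Rightarrow> real. (\<forall>n\<ge>1. 1 \<le> k n) \<longrightarrow>
       (\<lambda>n. real n / ln (real n)) \<in> o(k) \<longrightarrow>
       (\<lambda>n. lonely_ratio n (k n)) \<longlonglongrightarrow> 0) \<and>
     (\<forall>(c::real) (k::nat \<Rightarrow> real). c > 1 \<longrightarrow> (\<forall>n\<ge>1. 1 \<le> k n) \<longrightarrow>
       (\<forall>\<^sub>F n in at_top. k n \<le> real n / (c * ln (real n))) \<longrightarrow>
       (\<forall>n\<ge>1. \<forall>m\<ge>1.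
          measure (detachment_space n)
            {\<omega> \<in> space (detachment_space n).
               \<exists>A \<subseteq> {..<n}. m \<le> card A \<and> (\<forall>i\<in>A. lonely n (k n) \<omega> i)}
          = measure (detachment_space n)
              {\<omega> \<in> space (detachment_space n). m \<le> num_lonely n (k n) \<omega>}) \<and>
       (\<exists>\<epsilon>::nat \<Rightarrow> real. \<epsilon> \<longlonglongrightarrow> 0 \<and>
          (\<forall>\<^sub>F n in at_top. \<forall>m\<ge>1.
             measure (detachment_space n)
               {\<omega> \<in> space (detachment_space n). m \<le> num_lonely n (k n) \<omega>}
             \<le> 1 / (real m * real n powr (c - 1 + \<epsilon> n)))))"
proof (intro conjI allI impI)
  fix \<alpha> :: real assume \<alpha>: "\<alpha> > 0"
  show "(\<forall>k::nat \<Rightarrow> real. (\<forall>n\<ge>1. 1 \<le> k n) \<longrightarrow>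
           k \<sim>[at_top] (\<lambda>n. real n / (\<alpha> * ln (real n))) \<longrightarrow>
           (\<lambda>n. lonely_ratio n (k n)) \<longlonglongrightarrow> 0) \<longleftrightarrow> \<alpha> < 1"
    (is "?all \<longleftrightarrow> _")
  proof
    assume ?all
    then show "\<alpha> < 1" using critical_counterexample[of \<alpha>] by (metis not_less)
  next
    assume "\<alpha> < 1"
    then show ?all using lonely_ratio_critical[OF \<alpha>] by auto
  qed
next
  fix \<alpha> :: real and k :: "nat \<Rightarrow> real"
  assume "\<alpha> > 0" "\<alpha> \<noteq> 1" "k \<sim>[at_top] (\<lambda>n. real n / (\<alpha> * ln (real n)))"
  then show "(\<lambda>n. lonely_ratio n (k n)) \<longlonglongrightarrow> 0 \<longleftrightarrow> \<alpha> < 1"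
    by (rule lonely_ratio_critical)
next
  fix k :: "nat \<Rightarrow> real"
  assume "\<forall>n\<ge>1. 1 \<le> k n" "(\<lambda>n. real n / ln (real n)) \<in> o(k)"
  then show "(\<lambda>n. lonely_ratio n (k n)) \<longlonglongrightarrow> 0"
    by (rule lonely_ratio_supercritical)
next
  fix c :: real and k :: "nat \<Rightarrow> real" and n m :: nat
  show "measure (detachment_space n)
      {\<omega> \<in> space (detachment_space n). \<exists>A\<subseteq>{..<n}. m \<le> card A \<and> (\<forall>i\<in>A. lonely n (k n) \<omega> i)}
    = measure (detachment_space n) {\<omega> \<in> space (detachment_space n). m \<le> num_lonely n (k n) \<omega>}"
    by (simp only: ex_lonely_subset_iff)
next
  fix c :: real and k :: "nat \<Rightarrow> real"
  assume c: "c > 1" and k1: "\<forall>n\<ge>1. 1 \<le> k n"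
    and k: "\<forall>\<^sub>F n in at_top. k n \<le> real n / (c * ln (real n))"
  show "\<exists>\<epsilon>::nat \<Rightarrow> real. \<epsilon> \<longlonglongrightarrow> 0 \<and>
      (\<forall>\<^sub>F n in at_top. \<forall>m\<ge>1.
        measure (detachment_space n)
          {\<omega> \<in> space (detachment_space n). m \<le> num_lonely n (k n) \<omega>}
        \<le> 1 / (real m * real n powr (c - 1 + \<epsilon> n)))"
  \<comment> \<open>Markov's inequality brings in \<open>m\<close> only through the factor
    \<open>1 / m\<close>, so one correction serves all \<open>m\<close>.\<close>
  proof (intro exI[of _ "\<lambda>n. - c / real n"] conjI)
    show "(\<lambda>n. - c / real n) \<longlonglongrightarrow> 0" by real_asymp
    show "\<forall>\<^sub>F n in at_top. \<forall>m\<ge>1.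
        measure (detachment_space n)
          {\<omega> \<in> space (detachment_space n). m \<le> num_lonely n (k n) \<omega>}
        \<le> 1 / (real m * real n powr (c - 1 + - c / real n))"
      using k eventually_ge_at_top[of 2]
    proof eventually_elim
      case (elim n)
      then show ?case using prob_num_lonely_ge_le[of "k n" n c] k1 c by simp
    qed
  qed
qed

end
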